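(* Let $f=(f_1,\dots,f_s):\mathbb{R}^n\to\mathbb{R}^s$ be a mapping and $K\subseteq\mathbb{R}^n$ a nonempty set. Assume that $\mathrm{SOL}^W(K,f)\ne\emptyset$. Then there exist $i_0\in\{1,\dots,s\}$ and $x_0\in K$ such that $f_{i_0}(x)=f_{i_0}(x_0)$ for every $x\in K_{x_0}$, where $K_{x_0}=\{x\in K: f_i(x)\le f_i(x_0),\ i=1,\dots,s\}$. Moreover, $x_0\in\mathrm{SOL}^W(K_{x_0},f)\subseteq\mathrm{SOL}^W(K,f)$.
   Context: For a nonempty set $C\subseteq\mathbb{R}^n$, $\mathrm{SOL}^W(C,f)$ is the set of weak Pareto efficient solutions of minimizing $f$ over $C$: the points $x^*\in C$ such that there is no $x\in C$ with $f_i(x)<f_i(x^* )$ for all $i=1,\dots,s$. No continuity of $f$ and no closedness of $K$ is assumed. *)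

theory Defs
  imports "HOL-Analysis.Analysis"
begin

text \<open>The strict inequalities are spelled out componentwise because the order \<open><\<close> on
  \<open>real ^ 's\<close> only means \<open>\<le>\<close> in all components and \<open>\<noteq>\<close>.\<close>

definition SOL_W :: "(real ^ 'n) set \<Rightarrow> (real ^ 'n \<Rightarrow> real ^ 's) \<Rightarrow> (real ^ 'n) set" where
  "SOL_W C f = {x' \<in> C. \<not> (\<exists>x\<in>C. \<forall>i. f x $ i < f x' $ i)}"

definition lower_section ::
    "(real ^ 'n) set \<Rightarrow> (real ^ 'n \<Rightarrow> real ^ 's) \<Rightarrow> real ^ 'n \<Rightarrow> (real ^ 'n) set" where
  "lower_section K f x0 = {x \<in> K. \<forall>i. f x $ i \<le> f x0 $ i}"

end

theory Submission
  imports Defs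
begin

text \<open>If no coordinate were constant on any lower section, then from a weakly efficient point one
  could strictly decrease the coordinates one after the other without ever increasing any of them;
  after finitely many steps all coordinates would be strictly smaller.\<close>

lemma lower_section_refl: "x \<in> K \<Longrightarrow> x \<in> lower_section K f x"
  by (simp add: lower_section_def)

lemma lower_section_trans:
  "y \<in> lower_section K f x \<Longrightarrow> z \<in> lower_section K f y \<Longrightarrow> z \<in> lower_section K f x"
  unfolding lower_section_def by (auto intro: order_trans)

text \<open>Induction on \<open>I\<close>: \<open>step\<close> is applied at the point
  \<open>y\<close> reached so far, not at \<open>x\<close>, so moving on to \<open>z\<close> lowers
  coordinate \<open>j\<close> and cannot undo the strict decreases already gained. The assumption
  \<open>step\<close> is what the negation of the constancy claim provides.\<close>

lemma lower_section_decrease_all: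
  assumes step: "\<And>i x. x \<in> K \<Longrightarrow> \<exists>y\<in>lower_section K f x. f y $ i < f x $ i"
    and "finite I" and "x \<in> K"
  shows "\<exists>y\<in>lower_section K f x. \<forall>i\<in>I. f y $ i < f x $ i"
  using \<open>finite I\<close>
proof induction
  case empty
  show ?case using lower_section_refl[OF \<open>x \<in> K\<close>] by blast
next
  case (insert j I)
  then obtain y where y: "y \<in> lower_section K f x" "\<forall>i\<in>I. f y $ i < f x $ i"
    by blast
  from y(1) have "y \<in> K" by (simp add: lower_section_def)
  from step[OF this, of j] obtain z where z: "z \<in> lower_section K f y" "f z $ j < f y $ j"
    by blast
  \<comment> \<open>For \<open>j\<close> strictness comes from the move to \<open>z\<close>, for
    members of \<open>I\<close> from the move to \<open>y\<close>; the other move is weakly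
    decreasing.\<close>
  have "f z $ i < f x $ i" if "i \<in> insert j I" for i
  proof -
    have "f z $ i \<le> f y $ i" "f y $ i \<le> f x $ i"
      using y(1) z(1) by (simp_all add: lower_section_def)
    then show ?thesis
      using that y(2) z(2) by (auto intro: le_less_trans less_le_trans)
  qed
  then show ?case using lower_section_trans[OF y(1) z(1)] by blast
qed

text \<open>A point of \<open>K\<close> strictly below \<open>z\<close> in every coordinate lies in
  the section of \<open>z\<close>, hence by transitivity in that of \<open>x0\<close>, so it would
  already refute efficiency within the section.\<close>

lemma SOL_W_lower_section_subset: "SOL_W (lower_section K f x0) f \<subseteq> SOL_W K f"
proof
  fix z assume "z \<in> SOL_W (lower_section K f x0) f"
  then have z: "z \<in> lower_section K f x0"
    and eff: "\<And>x. x \<in> lower_section K f x0 \<Longrightarrow> \<not> (\<forall>i. f x $ i < f z $ i)"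
    by (auto simp: SOL_W_def)
  have "\<not> (\<forall>i. f x $ i < f z $ i)" if "x \<in> K" for x
  proof
    assume less: "\<forall>i. f x $ i < f z $ i"
    then have "x \<in> lower_section K f z"
      using \<open>x \<in> K\<close> by (simp add: lower_section_def less_imp_le)
    then show False using eff lower_section_trans[OF z] less by blast
  qed
  then show "z \<in> SOL_W K f" using z by (auto simp: SOL_W_def lower_section_def)
qed

theorem proposition3p1:
  fixes f :: "real ^ 'n \<Rightarrow> real ^ 's" and K :: "(real ^ 'n) set"
  assumes "K \<noteq> {}"
    and "SOL_W K f \<noteq> {}"
  shows "\<exists>i0. \<exists>x0\<in>K.
    (\<forall>x\<in>lower_section K f x0. f x $ i0 = f x0 $ i0) \<and>
    x0 \<in> SOL_W (lower_section K f x0) f \<and>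
    SOL_W (lower_section K f x0) f \<subseteq> SOL_W K f"
proof -
  obtain x' where "x' \<in> SOL_W K f"
    using assms(2) by blast
  then have x': "x' \<in> K" and eff: "\<And>x. x \<in> K \<Longrightarrow> \<not> (\<forall>i. f x $ i < f x' $ i)"
    by (auto simp: SOL_W_def)
  have "\<exists>i0. \<exists>x0\<in>K. \<forall>x\<in>lower_section K f x0. f x $ i0 = f x0 $ i0"
  proof (rule ccontr)
    assume contra: "\<not> ?thesis"
    have step: "\<exists>y\<in>lower_section K f x. f y $ i < f x $ i" if "x \<in> K" for i x
    proof -
      from contra have "\<not> (\<exists>x0\<in>K. \<forall>y\<in>lower_section K f x0. f y $ i = f x0 $ i)"
        by simp
      with that have "\<not> (\<forall>y\<in>lower_section K f x. f y $ i = f x $ i)"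
        by (intro notI) (erule notE, rule bexI)
      \<comment> \<open>Inside the section coordinate \<open>i\<close> cannot exceed its value at
        \<open>x\<close>, so a different value is strictly smaller.\<close>
      then obtain y where y: "y \<in> lower_section K f x" "f y $ i \<noteq> f x $ i"
        by blast
      from y(1) have "f y $ i \<le> f x $ i"
        by (simp add: lower_section_def)
      with y show ?thesis by (intro bexI[of _ y]) simp_all
    qed
    \<comment> \<open>Decreasing all of the finitely many coordinates from \<open>x'\<close>
      contradicts its weak efficiency.\<close>
    obtain y where y: "y \<in> lower_section K f x'" and less: "\<forall>i\<in>UNIV. f y $ i < f x' $ i"
      using lower_section_decrease_all[OF step finite_class.finite_UNIV x'] by blast
    from y have "y \<in> K" by (simp add: lower_section_def)
    from eff[OF this] less show False by simp
  qed
  then obtain i0 x0 where x0: "x0 \<in> K"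
    and const: "\<forall>x\<in>lower_section K f x0. f x $ i0 = f x0 $ i0"
    by blast
  \<comment> \<open>A point of the section that beats \<open>x0\<close> would be strictly smaller in
    coordinate \<open>i0\<close> too, which is constant there.\<close>
  have "x0 \<in> SOL_W (lower_section K f x0) f"
    unfolding SOL_W_def using lower_section_refl[OF x0] const by (auto intro!: exI[of _ i0])
  with x0 const show ?thesis
    by (intro exI[of _ i0] bexI[of _ x0] conjI SOL_W_lower_section_subset)
qed

end
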